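(* Let $d\ge 1$ and $m\ge 1$ be integers, let $A,B$ be real $d\times d$ matrices (not necessarily commuting), let $\varphi:\{-m,-m+1,\dots,1\}\to\mathbb{R}^d$ be a function, and let $f:\mathbb{Z}_{\ge 0}\to\mathbb{R}^d$ be exponentially bounded. Let $y:\{-m,-m+1,\dots\}\to\mathbb{R}^d$ be the (unique) solution of the initial value problem $$\Delta^2 y(t)+Ay(t)+By(t-m)=f(t)\quad (t\in\mathbb{Z}_{\ge 0}),\qquad y(t)=\varphi(t)\quad (t\in\{-m,\dots,1\}).$$ Then for every integer $t\ge 2$, $$y(t)=\mathrm{Cos}^{A,B}(t)\,\varphi(0)+\mathrm{Sin}^{A,B}(t)\,\Delta\varphi(0)-\sum_{i=-m}^{-1}\mathrm{Sin}^{A,B}(t-i-m-1)\,B\,\varphi(i)+\sum_{j=0}^{t-2}\mathrm{Sin}^{A,B}(t-j-1)\,f(j).$$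
   Context: Notation: $\Delta x(t)=x(t+1)-x(t)$ and $\Delta^2x(t)=x(t+2)-2x(t+1)+x(t)$; $\Theta$ and $I$ are the zero and identity $d\times d$ matrices. A function $f:\mathbb{Z}_{\ge0}\to\mathbb{R}^d$ is exponentially bounded if there exist $b_1,b_2>0$ with $\|f(t)\|\le b_1b_2^t$ for all $t\in\mathbb{Z}_{\ge0}$. Binomial convention: for integers $a$ and $b\ge 0$, $\binom{a}{b}=\frac{a!}{b!(a-b)!}$ if $0\le b\le a$, and $\binom{a}{b}=0$ if $b>a$ or $a<0$. Determining matrices: $Q(t;s)$ (for integers $t\ge 0$ and $s$) are the $d\times d$ matrices defined by $Q(0;s)=\Theta$ for all $s$, $Q(1;0)=I$, $Q(1;s)=\Theta$ for $s\neq 0$, and $Q(t+1;s)=A\,Q(t;s)+B\,Q(t;s-1)$ for $t\ge 1$ (so $Q(t;s)=\Theta$ for $s<0$). Delayed discrete matrix sine and cosine: for integers $t$, $$\mathrm{Sin}^{A,B}(t)=\sum_{l=0}^{\infty}\sum_{i=0}^{l}(-1)^l\binom{t-im}{2l+1}Q(l+1;i),\qquad \mathrm{Cos}^{A,B}(t)=\sum_{l=0}^{\infty}\sum_{i=0}^{l}(-1)^l\binom{t-im}{2l}Q(l+1;i).$$ Only finitely many terms are nonzero for each $t$; by the binomial convention both vanish for $t<0$. *)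

theory Defs
  imports "HOL-Analysis.Analysis"
begin

definition fwd_diff :: "(int \<Rightarrow> 'a::real_vector) \<Rightarrow> int \<Rightarrow> 'a" where
  "fwd_diff x t = x (t + 1) - x t"

definition fwd_diff2 :: "(int \<Rightarrow> 'a::real_vector) \<Rightarrow> int \<Rightarrow> 'a" where
  "fwd_diff2 x t = x (t + 2) - 2 *\<^sub>R x (t + 1) + x t"

definition exp_bounded :: "(nat \<Rightarrow> 'a::real_normed_vector) \<Rightarrow> bool" where
  "exp_bounded f \<longleftrightarrow> (\<exists>b1>0. \<exists>b2>0. \<forall>t. norm (f t) \<le> b1 * b2 ^ t)"

text \<open>Binomial coefficients vanish for a negative upper argument, unlike the generalised
  binomial coefficients of the library (\<open>gchoose\<close>).\<close>

definition zbinom :: "int \<Rightarrow> nat \<Rightarrow> real" where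
  "zbinom a b = (if a < 0 then 0 else real (nat a choose b))"

fun Q :: "real^'d^'d \<Rightarrow> real^'d^'d \<Rightarrow> nat \<Rightarrow> int \<Rightarrow> real^'d^'d" where
  "Q A B 0 s = 0"
| "Q A B (Suc 0) s = (if s = 0 then mat 1 else 0)"
| "Q A B (Suc (Suc t)) s = A ** Q A B (Suc t) s + B ** Q A B (Suc t) (s - 1)"

definition Sin_term :: "int \<Rightarrow> real^'d^'d \<Rightarrow> real^'d^'d \<Rightarrow> int \<Rightarrow> nat \<Rightarrow> real^'d^'d" where
  "Sin_term m A B t l =
     (\<Sum>i=0..l. ((-1) ^ l * zbinom (t - int i * m) (2 * l + 1)) *\<^sub>R Q A B (l + 1) (int i))"

definition Cos_term :: "int \<Rightarrow> real^'d^'d \<Rightarrow> real^'d^'d \<Rightarrow> int \<Rightarrow> nat \<Rightarrow> real^'d^'d" where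
  "Cos_term m A B t l =
     (\<Sum>i=0..l. ((-1) ^ l * zbinom (t - int i * m) (2 * l)) *\<^sub>R Q A B (l + 1) (int i))"

definition Sin_delayed :: "int \<Rightarrow> real^'d^'d \<Rightarrow> real^'d^'d \<Rightarrow> int \<Rightarrow> real^'d^'d" where
  "Sin_delayed m A B t = (\<Sum>l. Sin_term m A B t l)"

definition Cos_delayed :: "int \<Rightarrow> real^'d^'d \<Rightarrow> real^'d^'d \<Rightarrow> int \<Rightarrow> real^'d^'d" where
  "Cos_delayed m A B t = (\<Sum>l. Cos_term m A B t l)"

text \<open>For nonnegative delay only finitely many terms are nonzero, so both series converge.\<close>

lemma zbinom_delay_eq_0:
  assumes "m \<ge> 0" "t < int k"
  shows "zbinom (t - int i * m) k = 0"
proof -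
  have "0 \<le> int i * m" using assms(1) by simp
  then have "t - int i * m < int k" using assms(2) by linarith
  then show ?thesis by (auto simp: zbinom_def intro: binomial_eq_0)
qed

lemma summable_Sin_term:
  assumes "m \<ge> 0"
  shows "summable (Sin_term m A B t)"
proof (rule summable_finite[of "{..nat t}"])
  fix l assume "l \<notin> {..nat t}"
  then have "t < int (2 * l + 1)" by auto
  then show "Sin_term m A B t l = 0"
    unfolding Sin_term_def using zbinom_delay_eq_0[OF assms, of t "2 * l + 1"] by simp
qed simp

lemma summable_Cos_term:
  assumes "m \<ge> 0"
  shows "summable (Cos_term m A B t)"
proof (rule summable_finite[of "{..nat t}"])
  fix l assume "l \<notin> {..nat t}"
  then have "t < int (2 * l)" by auto
  then show "Cos_term m A B t l = 0"
    unfolding Cos_term_def using zbinom_delay_eq_0[OF assms, of t "2 * l"] by simp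
qed simp

text \<open>The history lives on \<open>{-m..1}\<close> and the solution on \<open>{-m..}\<close>; both are represented by total
  functions on \<open>int\<close> whose values outside these sets are unconstrained and never used.\<close>

definition solves_ivp ::
  "int \<Rightarrow> real^'d^'d \<Rightarrow> real^'d^'d \<Rightarrow> (int \<Rightarrow> real^'d) \<Rightarrow> (nat \<Rightarrow> real^'d) \<Rightarrow> (int \<Rightarrow> real^'d) \<Rightarrow> bool"
where
  "solves_ivp m A B \<phi> f y \<longleftrightarrow>
     (\<forall>t::nat. fwd_diff2 y (int t) + A *v y (int t) + B *v y (int t - m) = f t) \<and>
     (\<forall>t\<in>{-m..1}. y t = \<phi> t)"

end

theory Submission
  imports Defs
begin

text \<open>
  Write \<open>L u(t) = \<Delta>\<^sup>2 u(t) + A u(t) + B u(t - m)\<close>.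
  The delayed sine is the impulse response of \<open>L\<close>: on all of the integers,
  \<open>L Sin(t)\<close> is the identity for \<open>t = -1\<close> and zero otherwise; moreover \<open>Sin\<close> vanishes for
  \<open>t \<le> 0\<close>.  The delayed cosine solves \<open>L Cos(t) = 0\<close> for \<open>t \<ge> 0\<close>, vanishes for \<open>t < 0\<close> and equals
  the identity at \<open>0\<close> and \<open>1\<close>.  Both facts are instances of one computation
  (\<open>delayed_series_equation\<close>): applying \<open>\<Delta>\<^sup>2\<close> to the term with index \<open>l + 1\<close> lowers the binomial by
  two, and the recursion of the determining matrices then turns it into minus \<open>A\<close> times term \<open>l\<close>
  at \<open>t\<close> minus \<open>B\<close> times term \<open>l\<close> at \<open>t - m\<close>.  Summing over \<open>l\<close> leaves only the second
  difference of the term with index \<open>0\<close>.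

  By superposition this gives the solution formula for functions that vanish at negative times
  (\<open>variation_of_constants\<close>).  The general problem reduces to this one: replace the solution
  \<open>y\<close> by zero at negative times and move the history terms \<open>B \<phi>(t - m)\<close>, which occur
  for \<open>0 \<le> t < m\<close>, to the right-hand side.  So the history acts as the additional force
  \<open>- B \<phi>(j - m)\<close> at time \<open>j\<close>, and this is the sum over \<open>i = j - m\<close> in the formula.
\<close>

section \<open>Binomials and determining matrices\<close>

lemma zbinom_Suc: "zbinom (a + 1) (Suc k) = zbinom a k + zbinom a (Suc k)"
proof (cases "a \<ge> 0")
  case True
  then show ?thesis by (simp add: zbinom_def nat_add_distrib)
next
  case False
  then have "a = -1 \<or> a + 1 < 0" by linarith
  then show ?thesis using False by (auto simp: zbinom_def)
qed

text \<open>The vanishing convention at negative upper arguments is compatible with Pascal's rule, so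
  this holds on all of the integers; this is what makes the delay shifts harmless.\<close>

lemma fwd_diff2_zbinom: "fwd_diff2 (\<lambda>s. zbinom (s - c) (k + 2)) t = zbinom (t - c) k"
  using zbinom_Suc[of "t - c + 1" "Suc k"] zbinom_Suc[of "t - c" "Suc k"] zbinom_Suc[of "t - c" k]
  by (simp add: fwd_diff2_def algebra_simps)

lemma Q_eq_0_outside: "s < 0 \<or> s \<ge> int t \<Longrightarrow> Q A B t s = 0"
proof (induction t arbitrary: s)
  case (Suc t)
  show ?case
  proof (cases t)
    case (Suc t')
    with Suc.prems Suc.IH[of s] Suc.IH[of "s - 1"] show ?thesis by auto
  qed (use Suc.prems in auto)
qed simp

section \<open>The common series of sine and cosine\<close>

text \<open>The offset \<open>p\<close> treats the sine (\<open>p = 1\<close>) and the cosine (\<open>p = 0\<close>) at once.\<close>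

definition delayed_term ::
  "nat \<Rightarrow> int \<Rightarrow> real^'d^'d \<Rightarrow> real^'d^'d \<Rightarrow> int \<Rightarrow> nat \<Rightarrow> real^'d^'d" where
  "delayed_term p m A B t l =
     (\<Sum>i=0..l. ((-1) ^ l * zbinom (t - int i * m) (2 * l + p)) *\<^sub>R Q A B (l + 1) (int i))"

definition delayed_series ::
  "nat \<Rightarrow> int \<Rightarrow> real^'d^'d \<Rightarrow> real^'d^'d \<Rightarrow> int \<Rightarrow> real^'d^'d" where
  "delayed_series p m A B t = (\<Sum>l. delayed_term p m A B t l)"

lemma Sin_delayed_eq: "Sin_delayed m A B = delayed_series 1 m A B"
  by (simp add: fun_eq_iff Sin_delayed_def delayed_series_def Sin_term_def delayed_term_def)

lemma Cos_delayed_eq: "Cos_delayed m A B = delayed_series 0 m A B"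
  by (simp add: fun_eq_iff Cos_delayed_def delayed_series_def Cos_term_def delayed_term_def)

lemma delayed_term_eq_0: "m \<ge> 0 \<Longrightarrow> t < int (2 * l + p) \<Longrightarrow> delayed_term p m A B t l = 0"
  unfolding delayed_term_def using zbinom_delay_eq_0[of m t "2 * l + p"] by simp

lemma summable_delayed_term:
  assumes "m \<ge> 0"
  shows "summable (delayed_term p m A B t)"
proof (rule summable_finite[of "{..nat t}"])
  fix l assume "l \<notin> {..nat t}"
  then show "delayed_term p m A B t l = 0"
    using assms by (intro delayed_term_eq_0) auto
qed simp

lemma delayed_term_0: "delayed_term p m A B t 0 = zbinom t p *\<^sub>R mat 1"
  by (simp add: delayed_term_def)

lemma delayed_series_le_1:
  assumes "m \<ge> 0" "t \<le> 1"
  shows "delayed_series p m A B t = zbinom t p *\<^sub>R mat 1"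
proof -
  have "delayed_term p m A B t l = 0" if "l \<notin> {0}" for l
    using that assms by (intro delayed_term_eq_0) auto
  then have "delayed_series p m A B t = (\<Sum>l\<in>{0}. delayed_term p m A B t l)"
    unfolding delayed_series_def by (intro suminf_finite) auto
  then show ?thesis by (simp add: delayed_term_0)
qed

lemma matrix_scaleR_right:
  fixes A B :: "real^'d^'d"
  shows "A ** (c *\<^sub>R B) = c *\<^sub>R (A ** B)"
  by (simp only: matrix_scalar_ac scalar_matrix_assoc)

lemma linear_matrix_mult_left:
  fixes A :: "real^'d^'d"
  shows "linear (\<lambda>X :: real^'d^'d. A ** X)"
  by (intro linearI) (simp_all add: matrix_add_ldistrib matrix_scaleR_right)

lemma fwd_diff2_sum: "fwd_diff2 (\<lambda>s. \<Sum>i\<in>I. g i s) t = (\<Sum>i\<in>I. fwd_diff2 (g i) t)"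
  by (simp add: fwd_diff2_def sum.distrib sum_subtractf scaleR_sum_right)

lemma fwd_diff2_scaleR:
  "fwd_diff2 (\<lambda>s. (c * g s) *\<^sub>R X) t = (c * fwd_diff2 g t) *\<^sub>R X"
  by (simp add: fwd_diff2_def algebra_simps)

text \<open>The second difference lowers the binomial by two; splitting \<open>Q(l + 2; i)\<close> by its recursion
  and shifting the index in the \<open>B\<close> part produces the delay.  The boundary terms of the two
  sums vanish because \<open>Q(l + 1; i)\<close> is supported on \<open>0 \<le> i \<le> l\<close>.\<close>

lemma fwd_diff2_delayed_term_Suc:
  "fwd_diff2 (\<lambda>s. delayed_term p m A B s (Suc l)) t =
     - (A ** delayed_term p m A B t l + B ** delayed_term p m A B (t - m) l)"
proof -
  define c where "c i = (-1) ^ l * zbinom (t - int i * m) (2 * l + p)" for i :: nat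
  let ?Q = "Q A B (Suc l)"
  have idx: "2 * Suc l + p = (2 * l + p) + 2" by simp
  have "fwd_diff2 (\<lambda>s. delayed_term p m A B s (Suc l)) t =
      (\<Sum>i=0..Suc l. (- c i) *\<^sub>R Q A B (Suc (Suc l)) (int i))"
    unfolding delayed_term_def fwd_diff2_sum fwd_diff2_scaleR idx fwd_diff2_zbinom
    by (simp add: c_def)
  also have "\<dots> = - ((\<Sum>i=0..Suc l. c i *\<^sub>R (A ** ?Q (int i)))
                   + (\<Sum>i=0..Suc l. c i *\<^sub>R (B ** ?Q (int i - 1))))"
    by (simp only: Q.simps scaleR_minus_left sum_negf scaleR_add_right sum.distrib
        minus_add_distrib)
  also have "(\<Sum>i=0..Suc l. c i *\<^sub>R (A ** ?Q (int i))) = A ** delayed_term p m A B t l"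
    by (simp add: Q_eq_0_outside delayed_term_def c_def matrix_scaleR_right
        linear_sum[OF linear_matrix_mult_left])
  also have "(\<Sum>i=0..Suc l. c i *\<^sub>R (B ** ?Q (int i - 1))) =
      (\<Sum>i=0..l. c (Suc i) *\<^sub>R (B ** ?Q (int i)))"
    unfolding sum.atLeast0_atMost_Suc_shift by (simp add: Q_eq_0_outside)
  also have "\<dots> = B ** delayed_term p m A B (t - m) l"
    by (simp add: delayed_term_def c_def matrix_scaleR_right algebra_simps
        linear_sum[OF linear_matrix_mult_left])
  finally show ?thesis .
qed

lemma delayed_series_equation:
  fixes A B :: "real^'d^'d"
  assumes m: "m \<ge> 0"
  shows "fwd_diff2 (delayed_series p m A B) t + A ** delayed_series p m A B t
           + B ** delayed_series p m A B (t - m) = fwd_diff2 (\<lambda>s. zbinom s p) t *\<^sub>R mat 1"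
proof -
  let ?T = "delayed_term p m A B" and ?G = "delayed_series p m A B"
  define D where "D l = fwd_diff2 (\<lambda>s. ?T s l) t" for l
  have sums: "?T s sums ?G s" for s
    using summable_delayed_term[OF m] unfolding delayed_series_def by (rule summable_sums)
  have mult: "(\<lambda>l. X ** ?T s l) sums (X ** ?G s)" for X :: "real^'d^'d" and s
    using linear_matrix_mult_left[of X, unfolded linear_conv_bounded_linear] sums
    by (rule bounded_linear.sums)
  have "D sums fwd_diff2 ?G t"
    unfolding D_def fwd_diff2_def
    by (intro sums_add sums_diff sums_scaleR_right sums)
  moreover have "(\<lambda>l. D (Suc l)) sums (- (A ** ?G t + B ** ?G (t - m)))"
    unfolding D_def fwd_diff2_delayed_term_Suc by (intro sums_minus sums_add mult)
  then have "D sums (- (A ** ?G t + B ** ?G (t - m)) + D 0)"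
    by (rule sums_Suc)
  ultimately have "fwd_diff2 ?G t = - (A ** ?G t + B ** ?G (t - m)) + D 0"
    by (rule sums_unique2)
  moreover have "D 0 = fwd_diff2 (\<lambda>s. zbinom s p) t *\<^sub>R mat 1"
    using fwd_diff2_scaleR[of 1 "\<lambda>s. zbinom s p" "mat 1 :: real^'d^'d" t]
    by (simp add: D_def delayed_term_0)
  ultimately show ?thesis by simp
qed

section \<open>Sine and cosine as solutions of the delay equation\<close>

definition delay_op ::
  "int \<Rightarrow> real^'d^'d \<Rightarrow> real^'d^'d \<Rightarrow> (int \<Rightarrow> real^'d) \<Rightarrow> int \<Rightarrow> real^'d" where
  "delay_op m A B u t = fwd_diff2 u t + A *v u t + B *v u (t - m)"

text \<open>The operator has constant coefficients, so the equation for the series carries over to its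
  translates applied to a fixed vector.\<close>

lemma delay_op_delayed_series:
  fixes A B :: "real^'d^'d"
  assumes "m \<ge> 0"
  shows "delay_op m A B (\<lambda>s. delayed_series p m A B (s - c) *v v) t =
           fwd_diff2 (\<lambda>s. zbinom s p) (t - c) *\<^sub>R v"
proof -
  let ?G = "delayed_series p m A B"
  have "delay_op m A B (\<lambda>s. ?G (s - c) *v v) t =
      (fwd_diff2 ?G (t - c) + A ** ?G (t - c) + B ** ?G (t - c - m)) *v v"
    by (simp add: delay_op_def fwd_diff2_def scaleR_matrix_vector_assoc[symmetric]
        matrix_vector_mul_assoc algebra_simps)
  then show ?thesis
    by (simp add: delayed_series_equation[OF assms] scaleR_matrix_vector_assoc[symmetric])
qed

lemma delay_op_Cos_delayed:
  assumes "m \<ge> 0" "t \<ge> 0"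
  shows "delay_op m A B (\<lambda>s. Cos_delayed m A B s *v v) t = 0"
  using delay_op_delayed_series[OF assms(1), of A B 0 0 v t] assms(2)
  by (simp add: Cos_delayed_eq fwd_diff2_def zbinom_def)

lemma delay_op_Sin_delayed:
  assumes "m \<ge> 0"
  shows "delay_op m A B (\<lambda>s. Sin_delayed m A B (s - c) *v v) t = (if t - c = -1 then v else 0)"
proof -
  have "fwd_diff2 (\<lambda>s. zbinom s 1) r = (if r = -1 then 1 else 0)" for r
  proof -
    consider "r \<ge> 0" | "r = -1" | "r = -2" | "r < -2" by linarith
    then show ?thesis by cases (auto simp: fwd_diff2_def zbinom_def)
  qed
  then show ?thesis
    using delay_op_delayed_series[OF assms, of A B 1 c v t] by (simp add: Sin_delayed_eq)
qed

lemma Sin_delayed_nonpos: "m \<ge> 0 \<Longrightarrow> t \<le> 0 \<Longrightarrow> Sin_delayed m A B t = 0"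
  by (simp add: Sin_delayed_eq delayed_series_le_1 zbinom_def)

lemma Sin_delayed_1: "m \<ge> 0 \<Longrightarrow> Sin_delayed m A B 1 = mat 1"
  by (simp add: Sin_delayed_eq delayed_series_le_1 zbinom_def)

lemma Cos_delayed_neg: "m \<ge> 0 \<Longrightarrow> t < 0 \<Longrightarrow> Cos_delayed m A B t = 0"
  by (simp add: Cos_delayed_eq delayed_series_le_1 zbinom_def)

lemma Cos_delayed_0_1: "m \<ge> 0 \<Longrightarrow> t \<in> {0, 1} \<Longrightarrow> Cos_delayed m A B t = mat 1"
  by (auto simp: Cos_delayed_eq delayed_series_le_1 zbinom_def)

section \<open>Superposition and uniqueness\<close>

lemma delay_op_add: "delay_op m A B (\<lambda>s. u s + v s) t = delay_op m A B u t + delay_op m A B v t"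
  by (simp add: delay_op_def fwd_diff2_def matrix_vector_right_distrib algebra_simps)

lemma delay_op_sum:
  "delay_op m A B (\<lambda>s. \<Sum>j\<in>J. g j s) t = (\<Sum>j\<in>J. delay_op m A B (g j) t)"
  by (simp add: delay_op_def fwd_diff2_sum sum.distrib
      linear_sum[OF matrix_vector_mul_linear])

text \<open>The equation at time \<open>t\<close> determines the value at \<open>t + 2\<close> from values at times \<open>\<le> t + 1\<close>.\<close>

lemma delay_op_unique:
  assumes m: "m \<ge> 0"
    and init: "\<And>s. s \<le> 1 \<Longrightarrow> u s = v s"
    and eq: "\<And>n :: nat. n < N \<Longrightarrow> delay_op m A B u (int n) = delay_op m A B v (int n)"
    and le: "s \<le> int N + 1"
  shows "u s = v s"
  using eq le
proof (induction N arbitrary: s)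
  case 0
  then show ?case using init by simp
next
  case (Suc N)
  have IH: "u r = v r" if "r \<le> int N + 1" for r
    using Suc.IH Suc.prems(1) that by simp
  have "delay_op m A B u (int N) = delay_op m A B v (int N)"
    using Suc.prems(1) by simp
  moreover have "u (int N) = v (int N)" "u (int N + 1) = v (int N + 1)"
      "u (int N - m) = v (int N - m)"
    using m by (auto intro: IH)
  ultimately have "u (int N + 2) = v (int N + 2)"
    by (simp add: delay_op_def fwd_diff2_def)
  moreover have "s \<le> int N + 1 \<or> s = int N + 2"
    using Suc.prems(2) by auto
  ultimately show ?case using IH by blast
qed

text \<open>Superposition of impulse responses.  The summation bound \<open>N\<close> is independent of the time
  \<open>s\<close> so that both sides are functions of \<open>s\<close> to which \<open>delay_op_unique\<close> applies; the
  force at times \<open>j \<ge> s - 1\<close> does not contribute.\<close>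

lemma variation_of_constants:
  fixes A B :: "real^'d^'d" and g :: "nat \<Rightarrow> real^'d"
  assumes m: "m \<ge> 0"
    and neg: "\<And>s. s < 0 \<Longrightarrow> w s = 0"
    and eq: "\<And>n :: nat. n < N \<Longrightarrow> delay_op m A B w (int n) = g n"
    and le: "s \<le> int N + 1"
  shows "w s = Cos_delayed m A B s *v w 0 + Sin_delayed m A B s *v fwd_diff w 0
           + (\<Sum>j<N. Sin_delayed m A B (s - int j - 1) *v g j)"
proof -
  let ?S = "Sin_delayed m A B" and ?C = "Cos_delayed m A B"
  define z where "z s = ?C s *v w 0 + ?S s *v fwd_diff w 0
    + (\<Sum>j<N. ?S (s - (int j + 1)) *v g j)" for s
  have "w r = z r" if "r \<le> 1" for r
  proof -
    have no_force: "(\<Sum>j<N. ?S (r - (int j + 1)) *v g j) = 0"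
      using that m by (intro sum.neutral) (auto simp: Sin_delayed_nonpos)
    have "r < 0 \<or> r = 0 \<or> r = 1" using that by arith
    then consider "r < 0" | "r = 0" | "r = 1" by blast
    then show ?thesis
    proof cases
      case 1
      with no_force show ?thesis
        using m neg by (simp add: z_def Sin_delayed_nonpos Cos_delayed_neg)
    next
      case 2
      with no_force show ?thesis
        using m by (simp add: z_def Sin_delayed_nonpos Cos_delayed_0_1)
    next
      case 3
      with no_force show ?thesis
        using m by (simp add: z_def Sin_delayed_1 Cos_delayed_0_1 fwd_diff_def)
    qed
  qed
  moreover have "delay_op m A B w (int n) = delay_op m A B z (int n)" if "n < N" for n
  proof -
    have "delay_op m A B z (int n) = (\<Sum>j<N. if int n - (int j + 1) = -1 then g j else 0)"
      unfolding z_def delay_op_add delay_op_sum delay_op_Sin_delayed[OF m]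
      using delay_op_Cos_delayed[OF m, of "int n" A B "w 0"] delay_op_Sin_delayed[OF m, of A B 0]
      by simp
    also have "\<dots> = (\<Sum>j<N. if j = n then g j else 0)"
      by (intro sum.cong) auto
    also have "\<dots> = g n" using that by simp
    finally show ?thesis using eq[OF that] by simp
  qed
  ultimately have "w s = z s"
    using delay_op_unique[OF m _ _ le, of w z A B] by blast
  then show ?thesis by (simp add: z_def diff_diff_eq)
qed

section \<open>The solution formula\<close>

theorem theorem1:
  fixes A B :: "real^'d^'d"
    and m :: int
    and \<phi> y :: "int \<Rightarrow> real^'d"
    and f :: "nat \<Rightarrow> real^'d"
    and t :: nat
  assumes "m \<ge> 1"
    and "exp_bounded f"
    and "solves_ivp m A B \<phi> f y"
    and "t \<ge> 2"
  shows "y (int t) =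
           Cos_delayed m A B (int t) *v \<phi> 0
           + Sin_delayed m A B (int t) *v fwd_diff \<phi> 0
           - (\<Sum>i\<in>{-m..-1}. Sin_delayed m A B (int t - i - m - 1) *v (B *v \<phi> i))
           + (\<Sum>j=0..t-2. Sin_delayed m A B (int t - int j - 1) *v f j)"
proof -
  let ?S = "Sin_delayed m A B"
  have m: "m \<ge> 0" using assms(1) by simp
  have eq: "fwd_diff2 y (int n) + A *v y (int n) + B *v y (int n - m) = f n" for n
    using assms(3) by (simp add: solves_ivp_def)
  have init: "y s = \<phi> s" if "-m \<le> s" "s \<le> 1" for s
    using assms(3) that by (simp add: solves_ivp_def)

  define w where "w s = (if s < 0 then 0 else y s)" for s
  define h where "h n = (if int n < m then B *v \<phi> (int n - m) else 0)" for n
  have "delay_op m A B w (int n) = f n - h n" for n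
    using eq[of n] init[of "int n - m"]
    by (auto simp: delay_op_def fwd_diff2_def w_def h_def algebra_simps)
  moreover have "w s = 0" if "s < 0" for s
    using that by (simp add: w_def)
  \<comment> \<open>The bound covers both the force up to time \<open>t\<close> and the history times \<open>j < m\<close>.\<close>
  moreover define N where "N = t + nat m"
  ultimately have "w (int t) = Cos_delayed m A B (int t) *v w 0 + ?S (int t) *v fwd_diff w 0
      + (\<Sum>j<N. ?S (int t - int j - 1) *v (f j - h j))"
    using m by (intro variation_of_constants) auto
  moreover have "w (int t) = y (int t)" "w 0 = \<phi> 0" "fwd_diff w 0 = fwd_diff \<phi> 0"
    using init m by (simp_all add: w_def fwd_diff_def)
  moreover have "(\<Sum>j<N. ?S (int t - int j - 1) *v f j) =
      (\<Sum>j=0..t-2. ?S (int t - int j - 1) *v f j)"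
    using assms(4) m
    by (intro sum.mono_neutral_right) (auto simp: N_def Sin_delayed_nonpos)
  moreover have "(\<Sum>j<N. ?S (int t - int j - 1) *v h j) =
      (\<Sum>i\<in>{-m..-1}. ?S (int t - i - m - 1) *v (B *v \<phi> i))"
  proof -
    have "(\<Sum>j<N. ?S (int t - int j - 1) *v h j) =
        (\<Sum>j<nat m. ?S (int t - int j - 1) *v h j)"
      by (intro sum.mono_neutral_right) (auto simp: N_def h_def)
    also have "\<dots> = (\<Sum>i\<in>{-m..-1}. ?S (int t - i - m - 1) *v (B *v \<phi> i))"
      by (rule sum.reindex_bij_witness[of _ "\<lambda>i. nat (i + m)" "\<lambda>j. int j - m"])
        (auto simp: h_def)
    finally show ?thesis .
  qed
  ultimately show ?thesis
    by (simp add: matrix_vector_mult_diff_distrib sum_subtractf)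
qed

end
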